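(* Let $b>0$, $\beta\in(1,2]$, and let $f:\mathbb{R}\to\mathbb{R}$ be twice continuously differentiable. Let $g_{in}:[0,b^{-1/\beta})\to[0,e)$ satisfy condition G1 of the context, and define $$g(r)=\begin{cases}g_{in}(r),&r<b^{-1/\beta},\\ e^{br^\beta},&r\ge b^{-1/\beta}.\end{cases}$$ Then (1) $g\in\mathcal C^3((0,\infty))$; and (2) $g$ is onto (from $[0,\infty)$ to $[0,\infty)$), strictly monotonically increasing, and hence invertible.
   Context: Condition G1 on $g_{in}$: $g_{in}:[0,b^{-1/\beta})\to[0,e)$ is onto, monotone increasing and twice continuously differentiable; $g_{in}(0)=0$; as $r\to (b^{-1/\beta})_-$ one has $g_{in}(r)\to e$, $g_{in}'(r)\to\beta b^{1/\beta}e$, $g_{in}''(r)\to(2\beta^2-\beta)b^{2/\beta}e$, $g_{in}'''(r)\to(5\beta^3-6\beta^2+2\beta)b^{3/\beta}e$; and, as $r\to0_+$, the limits of the absolute values of $f'(g_{in}(r))g_{in}'(r)/r$, $\frac1r\frac{d}{dr}\log g_{in}'(r)$, $\frac1r\frac{d}{dr}\log\frac{g_{in}(r)}{r}$, $\frac{d^2}{dr^2}\log\frac{g_{in}(r)}{r}$, $\frac{d^2}{dr^2}\log g_{in}'(r)$ are all $<\infty$. Here $f$ is the radial profile of an isotropic potential $x\mapsto f(|x|)$ on $\mathbb{R}^d$.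
   Formalization: g_in is assumed three times continuously differentiable on the open interval (0, b^{-1/β}), not only twice (with a kink in g_in'' inside the interval, claim (1) fails), and "monotone increasing" is taken as strictly increasing, which claim (2) needs. *)

theory Defs
  imports "HOL-Analysis.Analysis"
begin

text \<open>
  \<open>k\<close>-fold continuous differentiability on a nondegenerate interval \<open>S\<close>. The derivative is
  taken within \<open>S\<close>, so it is one-sided at an endpoint that belongs to \<open>S\<close>, and only the values
  of the function on \<open>S\<close> matter.
\<close>

primrec C_k_on :: "nat \<Rightarrow> real set \<Rightarrow> (real \<Rightarrow> real) \<Rightarrow> bool" where
  "C_k_on 0 S f \<longleftrightarrow> continuous_on S f"
| "C_k_on (Suc k) S f \<longleftrightarrow>
     (\<exists>f'. (\<forall>x\<in>S. (f has_real_derivative f' x) (at x within S)) \<and> C_k_on k S f')"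

definition has_finite_abs_limit_0 :: "(real \<Rightarrow> real) \<Rightarrow> bool" where
  "has_finite_abs_limit_0 h \<longleftrightarrow> (\<exists>L. ((\<lambda>r. \<bar>h r\<bar>) \<longlongrightarrow> L) (at_right 0))"

text \<open>
  A function on \<open>[0, b\<^sup>-\<^sup>1\<^sup>/\<^sup>\<beta>)\<close> is represented by a total function whose values elsewhere are
  irrelevant. \<open>Increasing\<close> is meant strictly. The condition mentions the third derivative of
  \<open>g\<^sub>i\<^sub>n\<close> (in the limit at the right endpoint and in the second derivative of \<open>log g\<^sub>i\<^sub>n'\<close>), so
  \<open>g\<^sub>i\<^sub>n\<close> is required to be \<open>C\<^sup>3\<close> on the open interval, in addition to being \<open>C\<^sup>2\<close> up to \<open>0\<close>.
  Positivity of \<open>g\<^sub>i\<^sub>n'\<close> near \<open>0\<close> is what makes \<open>log g\<^sub>i\<^sub>n'\<close> meaningful there;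
  \<open>g\<^sub>i\<^sub>n(r)/r > 0\<close> follows from the other conditions.
\<close>

definition G1 :: "real \<Rightarrow> real \<Rightarrow> (real \<Rightarrow> real) \<Rightarrow> (real \<Rightarrow> real) \<Rightarrow> bool" where
  "G1 b \<beta> f gin \<longleftrightarrow>
    (let R = b powr (- 1 / \<beta>) in
      gin ` {0..<R} = {0..<exp 1} \<and>
      strict_mono_on {0..<R} gin \<and>
      C_k_on 2 {0..<R} gin \<and>
      C_k_on 3 {0<..<R} gin \<and>
      gin 0 = 0 \<and>
      (gin \<longlongrightarrow> exp 1) (at_left R) \<and>
      (deriv gin \<longlongrightarrow> \<beta> * b powr (1 / \<beta>) * exp 1) (at_left R) \<and>
      ((deriv ^^ 2) gin \<longlongrightarrow> (2 * \<beta>^2 - \<beta>) * b powr (2 / \<beta>) * exp 1) (at_left R) \<and>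
      ((deriv ^^ 3) gin \<longlongrightarrow>
         (5 * \<beta>^3 - 6 * \<beta>^2 + 2 * \<beta>) * b powr (3 / \<beta>) * exp 1) (at_left R) \<and>
      eventually (\<lambda>r. deriv gin r > 0) (at_right 0) \<and>
      has_finite_abs_limit_0 (\<lambda>r. deriv f (gin r) * deriv gin r / r) \<and>
      has_finite_abs_limit_0 (\<lambda>r. 1 / r * deriv (\<lambda>s. ln (deriv gin s)) r) \<and>
      has_finite_abs_limit_0 (\<lambda>r. 1 / r * deriv (\<lambda>s. ln (gin s / s)) r) \<and>
      has_finite_abs_limit_0 ((deriv ^^ 2) (\<lambda>s. ln (gin s / s))) \<and>
      has_finite_abs_limit_0 ((deriv ^^ 2) (\<lambda>s. ln (deriv gin s))))"

definition glue :: "real \<Rightarrow> real \<Rightarrow> (real \<Rightarrow> real) \<Rightarrow> real \<Rightarrow> real" where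
  "glue b \<beta> gin r = (if r < b powr (- 1 / \<beta>) then gin r else exp (b * r powr \<beta>))"

end

theory Submission
  imports Defs
begin

text \<open>
  A piecewise function is \<open>C\<^sup>k\<close> across the junction as soon as the one-sided limits of the
  derivatives up to order \<open>k\<close> agree, by l'Hopital's rule. With \<open>y = b r\<^sup>\<beta>\<close> one has
  \<open>y' = \<beta> y / r\<close>, and \<open>y = 1\<close> at the junction \<open>r = b\<^sup>-\<^sup>1\<^sup>/\<^sup>\<beta>\<close>; so the derivatives of
  \<open>exp y\<close> there are exactly the limits prescribed by G1. Monotonicity and surjectivity hold
  because the inner part has range \<open>[0,e)\<close> and the outer part has range \<open>[e,\<infinity>)\<close>.
\<close>

section \<open>Gluing two C^k functions at a point\<close>

text \<open>Continuity at \<open>a\<close> makes the difference quotient a 0/0 form, and l'Hopital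
  turns it into the limit of \<open>D\<close>. This supplies the derivative at a junction, where
  neither piece agrees with the glued function on a full neighbourhood.\<close>

lemma has_real_derivative_from_limit:
  fixes F D :: "real \<Rightarrow> real"
  assumes cont: "isCont F a"
    and der: "\<forall>\<^sub>F x in at a. (F has_real_derivative D x) (at x)"
    and lim: "(D \<longlongrightarrow> l) (at a)"
  shows "(F has_real_derivative l) (at a)"
proof -
  have "((\<lambda>x. (F x - F a) / (x - a)) \<longlongrightarrow> l) (at a)"
  proof (rule lhopital)
    show "((\<lambda>x. F x - F a) \<longlongrightarrow> 0) (at a)"
      using cont by (simp add: isCont_def LIM_zero)
    show "((\<lambda>x. x - a) \<longlongrightarrow> 0) (at a)"
      by (simp add: LIM_zero)
    show "\<forall>\<^sub>F x in at a. x - a \<noteq> 0"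
      by (simp add: eventually_at_filter)
    show "\<forall>\<^sub>F x in at a. (1::real) \<noteq> 0"
      by simp
    show "\<forall>\<^sub>F x in at a. ((\<lambda>x. F x - F a) has_real_derivative D x) (at x)"
      using der by eventually_elim (auto intro!: derivative_eq_intros)
    show "\<forall>\<^sub>F x in at a. ((\<lambda>x. x - a) has_real_derivative 1) (at x)"
      by (intro always_eventually allI) (auto intro!: derivative_eq_intros)
    show "((\<lambda>x. D x / 1) \<longlongrightarrow> l) (at a)"
      using lim by simp
  qed
  then show ?thesis
    by (simp add: has_field_derivative_iff)
qed

lemma isCont_if_less:
  fixes p q :: "real \<Rightarrow> real"
  assumes "(p \<longlongrightarrow> q R) (at_left R)" and "isCont q R"
  shows "isCont (\<lambda>r. if r < R then p r else q r) R"
proof -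
  have "((\<lambda>r. if r < R then p r else q r) \<longlongrightarrow> q R) (at_left R)"
    by (rule Lim_transform_eventually[OF assms(1)]) (auto simp: eventually_at_filter)
  moreover have "((\<lambda>r. if r < R then p r else q r) \<longlongrightarrow> q R) (at_right R)"
    by (rule Lim_transform_eventually[of q])
       (use assms(2) in \<open>auto simp: eventually_at_filter isCont_def filterlim_at_split\<close>)
  ultimately show ?thesis
    by (simp add: isCont_def filterlim_at_split)
qed

lemma eventually_if_less_eq:
  fixes p q :: "real \<Rightarrow> real"
  shows "x < R \<Longrightarrow> \<forall>\<^sub>F r in nhds x. (if r < R then p r else q r) = p r"
    and "R < x \<Longrightarrow> \<forall>\<^sub>F r in nhds x. (if r < R then p r else q r) = q r"
proof -
  show "\<forall>\<^sub>F r in nhds x. (if r < R then p r else q r) = p r" if "x < R"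
    using eventually_nhds_in_open[OF open_lessThan, of x R] that
    by (auto elim!: eventually_mono)
  show "\<forall>\<^sub>F r in nhds x. (if r < R then p r else q r) = q r" if "R < x"
    using eventually_nhds_in_open[OF open_greaterThan, of x R] that
    by (auto elim!: eventually_mono)
qed

text \<open>A derivative within \<open>S\<close> at a point of \<open>S\<close> sees only values on
  \<open>S\<close>, so no openness is required.\<close>

lemma C_k_on_cong:
  assumes "\<And>x. x \<in> S \<Longrightarrow> f x = g x"
  shows "C_k_on k S f \<longleftrightarrow> C_k_on k S g"
proof (cases k)
  case 0
  then show ?thesis using assms by (simp cong: continuous_on_cong)
next
  case (Suc n)
  have "(f has_real_derivative D) (at x within S) \<longleftrightarrow> (g has_real_derivative D) (at x within S)"
    if "x \<in> S" for x D
    using assms that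
    by (intro has_field_derivative_cong_eventually) (auto simp: eventually_at_filter)
  with Suc show ?thesis by simp
qed

text \<open>On an open set the derivative within the set is the ordinary one and hence unique, so
  the existential witness agrees there with \<open>deriv f\<close>. This links \<open>C_k_on\<close>
  to the iterates of \<open>deriv\<close> in which the junction conditions are phrased.\<close>

lemma C_k_on_Suc_open:
  assumes "open S"
  shows "C_k_on (Suc k) S f \<longleftrightarrow>
    (\<forall>x\<in>S. (f has_real_derivative deriv f x) (at x)) \<and> C_k_on k S (deriv f)"
proof
  assume "C_k_on (Suc k) S f"
  then obtain f' where f': "\<And>x. x \<in> S \<Longrightarrow> (f has_real_derivative f' x) (at x)"
      and C: "C_k_on k S f'"
    by (auto simp: at_within_open[OF _ assms])
  have eq: "deriv f x = f' x" if "x \<in> S" for x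
    using f'[OF that] by (rule DERIV_imp_deriv)
  have "C_k_on k S (deriv f)"
    using C by (rule iffD2[OF C_k_on_cong[OF eq], rotated])
  moreover have "\<forall>x\<in>S. (f has_real_derivative deriv f x) (at x)"
    using f' eq by simp
  ultimately show "(\<forall>x\<in>S. (f has_real_derivative deriv f x) (at x)) \<and> C_k_on k S (deriv f)"
    by blast
next
  assume "(\<forall>x\<in>S. (f has_real_derivative deriv f x) (at x)) \<and> C_k_on k S (deriv f)"
  then show "C_k_on (Suc k) S f"
    unfolding C_k_on.simps by (blast intro: has_field_derivative_at_within)
qed

text \<open>Induction on \<open>k\<close> with \<open>p\<close> and \<open>q\<close> general: off
  \<open>R\<close> the derivative of the glued function is the gluing of \<open>deriv p\<close> and
  \<open>deriv q\<close>, which is of the same form one order lower. Since \<open>q\<close> is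
  smooth on both sides of \<open>R\<close>, only left limits of the derivatives of \<open>p\<close>
  have to be matched.\<close>

lemma C_k_on_if_less:
  fixes p q :: "real \<Rightarrow> real"
  assumes "a < R" and "C_k_on k {a<..<R} p" and "C_k_on k {a<..} q"
    and "\<And>j. j \<le> k \<Longrightarrow> ((deriv ^^ j) p \<longlongrightarrow> (deriv ^^ j) q R) (at_left R)"
  shows "C_k_on k {a<..} (\<lambda>r. if r < R then p r else q r)"
  using assms(2-)
proof (induction k arbitrary: p q)
  case 0
  let ?g = "\<lambda>r. if r < R then p r else q r"
  have "isCont ?g x" if "x > a" for x
  proof (cases x R rule: linorder_cases)
    case less
    then have "isCont p x"
      using 0 that by (simp add: continuous_on_eq_continuous_at)
    then show ?thesis
      using isCont_cong[OF eventually_if_less_eq(1)[OF less]] by simp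
  next
    case equal
    have "isCont q R"
      using 0 \<open>a < R\<close> by (simp add: continuous_on_eq_continuous_at)
    with 0(3)[of 0] show ?thesis
      unfolding equal by (intro isCont_if_less) auto
  next
    case greater
    then have "isCont q x"
      using 0 that by (simp add: continuous_on_eq_continuous_at)
    then show ?thesis
      using isCont_cong[OF eventually_if_less_eq(2)[OF greater]] by simp
  qed
  then show ?case
    by (simp add: continuous_on_eq_continuous_at)
next
  case (Suc k)
  let ?g = "\<lambda>r. if r < R then p r else q r"
  let ?g' = "\<lambda>r. if r < R then deriv p r else deriv q r"
  from Suc.prems have p: "\<And>x. a < x \<Longrightarrow> x < R \<Longrightarrow> (p has_real_derivative deriv p x) (at x)"
      and q: "\<And>x. a < x \<Longrightarrow> (q has_real_derivative deriv q x) (at x)"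
      and Cp: "C_k_on k {a<..<R} (deriv p)" and Cq: "C_k_on k {a<..} (deriv q)"
    unfolding C_k_on_Suc_open[OF open_greaterThan] C_k_on_Suc_open[OF open_greaterThanLessThan]
    by auto
  have lim: "((deriv ^^ j) (deriv p) \<longlongrightarrow> (deriv ^^ j) (deriv q) R) (at_left R)" if "j \<le> k" for j
    using Suc.prems(3)[of "Suc j"] that by (simp add: funpow_Suc_right del: funpow.simps)
  have C: "C_k_on k {a<..} ?g'"
    using Suc.IH[OF Cp Cq lim] .
  \<comment> \<open>For \<open>k = 0\<close> this is the definition; for larger \<open>k\<close> it
    follows from differentiability.\<close>
  then have "continuous_on {a<..} ?g'"
    by (cases k) (auto intro: DERIV_continuous_on)
  then have cont: "isCont ?g' R"
    using \<open>a < R\<close> by (simp add: continuous_on_eq_continuous_at)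
  have off: "(?g has_real_derivative ?g' x) (at x)" if "x > a" "x \<noteq> R" for x
  proof (cases "x < R")
    case True
    then show ?thesis
      using p[OF that(1) True] DERIV_cong_ev[OF refl eventually_if_less_eq(1)[OF True] refl] by simp
  next
    case False
    with that have "R < x" by simp
    then show ?thesis
      using q[OF that(1)] DERIV_cong_ev[OF refl eventually_if_less_eq(2)[OF \<open>R < x\<close>] refl] by simp
  qed
  \<comment> \<open>The continuity of \<open>?g'\<close> at \<open>R\<close>, known from the
    induction hypothesis, is the limit that l'Hopital needs.\<close>
  have at_R: "(?g has_real_derivative ?g' R) (at R)"
  proof (rule has_real_derivative_from_limit)
    show "isCont ?g R"
      using Suc.prems(3)[of 0] q[OF \<open>a < R\<close>] by (intro isCont_if_less) (auto intro: DERIV_isCont)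
    have "\<forall>\<^sub>F x in nhds R. x \<in> {a<..}"
      using \<open>a < R\<close> by (intro eventually_nhds_in_open) auto
    then show "\<forall>\<^sub>F x in at R. (?g has_real_derivative ?g' x) (at x)"
      unfolding eventually_at_filter
      by eventually_elim (use off in blast)
    show "(?g' \<longlongrightarrow> ?g' R) (at R)"
      using cont by (simp add: isCont_def)
  qed
  have "(?g has_real_derivative ?g' x) (at x)" if "x > a" for x
    using off[OF that] at_R by (cases "x = R") blast+
  then have "\<forall>x\<in>{a<..}. (?g has_real_derivative ?g' x) (at x within {a<..})"
    by (blast intro: has_field_derivative_at_within)
  with C show ?case
    unfolding C_k_on.simps by (intro exI[of _ ?g'] conjI)
qed

section \<open>The outer function exp(b r^\<beta>), its derivatives and junction values\<close>

context
  fixes b \<beta> :: real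
  assumes b: "b > 0" and \<beta>: "\<beta> > 1"
begin

definition "stretched_exp r = exp (b * r powr \<beta>)"
text \<open>These are the first three derivatives in closed form. They are written in terms of y = b
  r^\<beta>, so that evaluation at the junction amounts to setting y = 1.\<close>

definition "stretched_exp1 r = \<beta> * (b * r powr \<beta>) / r * stretched_exp r"
definition "stretched_exp2 r =
  \<beta> * (b * r powr \<beta>) / r^2 * (\<beta> - 1 + \<beta> * (b * r powr \<beta>)) * stretched_exp r"
definition "stretched_exp3 r =
  \<beta> * (b * r powr \<beta>) / r^3 * ((\<beta> - 1) * (\<beta> - 2) + 3 * \<beta> * (\<beta> - 1) * (b * r powr \<beta>)
    + \<beta>^2 * (b * r powr \<beta>)^2) * stretched_exp r"

lemma DERIV_scaled_powr:
  "r > 0 \<Longrightarrow> ((\<lambda>r. b * r powr \<beta>) has_real_derivative \<beta> * (b * r powr \<beta>) / r) (at r)"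
  by (auto intro!: derivative_eq_intros simp: powr_diff)

lemma DERIV_stretched_exp:
  assumes "r > 0"
  shows "(stretched_exp has_real_derivative stretched_exp1 r) (at r)"
    and "(stretched_exp1 has_real_derivative stretched_exp2 r) (at r)"
    and "(stretched_exp2 has_real_derivative stretched_exp3 r) (at r)"
proof -
  show 0: "(stretched_exp has_real_derivative stretched_exp1 r) (at r)"
    unfolding stretched_exp_def[abs_def] stretched_exp1_def
    by (rule DERIV_cong, rule DERIV_fun_exp, rule DERIV_scaled_powr[OF assms])
       (simp add: mult_ac)
  \<comment> \<open>With \<open>y\<close> opaque and y' = \<beta> y / r as the only rule for it, the
    remaining goals are rational identities in \<open>y\<close> and \<open>r\<close>.\<close>
  define y where "y = (\<lambda>r. b * r powr \<beta>)"
  have y: "(y has_real_derivative \<beta> * y r / r) (at r)"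
    unfolding y_def by (rule DERIV_scaled_powr[OF assms])
  have e: "(stretched_exp has_real_derivative \<beta> * y r / r * stretched_exp r) (at r)"
    using 0 by (simp add: stretched_exp1_def y_def)
  show "(stretched_exp1 has_real_derivative stretched_exp2 r) (at r)"
    unfolding stretched_exp1_def[abs_def] stretched_exp2_def fun_cong[OF y_def, symmetric]
    using assms by (auto intro!: derivative_eq_intros y e simp: field_simps power2_eq_square)
  show "(stretched_exp2 has_real_derivative stretched_exp3 r) (at r)"
    unfolding stretched_exp2_def[abs_def] stretched_exp3_def fun_cong[OF y_def, symmetric]
    using assms
    by (auto intro!: derivative_eq_intros y e simp: field_simps power2_eq_square power3_eq_cube)
qed

lemma C_3_on_stretched_exp: "C_k_on 3 {0<..} stretched_exp"
proof -
  have "continuous_on {0<..} stretched_exp3"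
    unfolding stretched_exp3_def[abs_def] stretched_exp_def[abs_def]
    by (intro continuous_intros) auto
  moreover have "\<forall>r\<in>{0<..}. (stretched_exp has_real_derivative stretched_exp1 r) (at r within {0<..})"
    "\<forall>r\<in>{0<..}. (stretched_exp1 has_real_derivative stretched_exp2 r) (at r within {0<..})"
    "\<forall>r\<in>{0<..}. (stretched_exp2 has_real_derivative stretched_exp3 r) (at r within {0<..})"
    using DERIV_stretched_exp by (auto intro: has_field_derivative_at_within)
  ultimately show ?thesis
    unfolding numeral_3_eq_3 C_k_on.simps by blast
qed

text \<open>The value of \<open>deriv\<close> at a point depends on a neighbourhood, so each order
  uses that the previous formula holds at all positive points near \<open>r\<close>.\<close>

lemma higher_deriv_stretched_exp:
  assumes "r > 0"
  shows "deriv stretched_exp r = stretched_exp1 r"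
    and "(deriv ^^ 2) stretched_exp r = stretched_exp2 r"
    and "(deriv ^^ 3) stretched_exp r = stretched_exp3 r"
proof -
  have ev: "\<forall>\<^sub>F x in nhds r. x > 0" if "r > 0" for r :: real
    using eventually_nhds_in_open[OF open_greaterThan, of r 0] that by simp
  have 1: "deriv stretched_exp r = stretched_exp1 r" if "r > 0" for r
    using DERIV_stretched_exp(1)[OF that] by (rule DERIV_imp_deriv)
  have 2: "deriv (deriv stretched_exp) r = stretched_exp2 r" if "r > 0" for r
    using deriv_cong_ev[OF eventually_mono[OF ev[OF that] 1] refl]
      DERIV_imp_deriv[OF DERIV_stretched_exp(2)[OF that]] by simp
  have 3: "deriv (deriv (deriv stretched_exp)) r = stretched_exp3 r" if "r > 0" for r
    using deriv_cong_ev[OF eventually_mono[OF ev[OF that] 2] refl]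
      DERIV_imp_deriv[OF DERIV_stretched_exp(3)[OF that]] by simp
  show "deriv stretched_exp r = stretched_exp1 r"
    and "(deriv ^^ 2) stretched_exp r = stretched_exp2 r"
    and "(deriv ^^ 3) stretched_exp r = stretched_exp3 r"
    using 1 2 3 assms by (simp_all add: numeral_2_eq_2 numeral_3_eq_3)
qed

lemma junction_powr: "b * (b powr (- 1 / \<beta>)) powr \<beta> = 1"
  unfolding powr_powr using b \<beta> by (simp add: powr_minus)

text \<open>Converts the factors 1/r^n of the derivative formulas, taken at the junction, into the
  powers of \<open>b\<close> that occur in \<open>G1\<close>.\<close>

lemma junction_power: "inverse ((b powr (- 1 / \<beta>)) ^ n) = b powr (real n / \<beta>)"
  using b by (simp add: powr_power powr_minus flip: powr_minus power_inverse)

text \<open>Setting y = 1 leaves polynomials in \<beta>; for the third order,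
  \<beta>((\<beta>-1)(\<beta>-2) + 3\<beta>(\<beta>-1) + \<beta>^2) = 5\<beta>^3 - 6\<beta>^2 +
  2\<beta>.\<close>

lemma stretched_exp_at_junction:
  defines "R \<equiv> b powr (- 1 / \<beta>)"
  shows "stretched_exp R = exp 1"
    and "stretched_exp1 R = \<beta> * b powr (1 / \<beta>) * exp 1"
    and "stretched_exp2 R = (2 * \<beta>^2 - \<beta>) * b powr (2 / \<beta>) * exp 1"
    and "stretched_exp3 R = (5 * \<beta>^3 - 6 * \<beta>^2 + 2 * \<beta>) * b powr (3 / \<beta>) * exp 1"
  using junction_power[of 1] junction_power[of 2] junction_power[of 3]
  unfolding R_def stretched_exp_def stretched_exp1_def stretched_exp2_def stretched_exp3_def
    junction_powr divide_inverse[of _ "_ ^ _"]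
  by (simp_all add: divide_inverse algebra_simps power2_eq_square power3_eq_cube)

section \<open>Monotonicity and range of the outer function\<close>

lemma stretched_exp_less:
  assumes "0 \<le> r" "r < s"
  shows "stretched_exp r < stretched_exp s"
  using b \<beta> assms by (simp add: stretched_exp_def powr_less_mono2)

lemma image_stretched_exp: "stretched_exp ` {b powr (- 1 / \<beta>)..} = {exp 1..}"
proof (intro equalityI subsetI)
  fix v assume "v \<in> stretched_exp ` {b powr (- 1 / \<beta>)..}"
  then obtain r where r: "b powr (- 1 / \<beta>) \<le> r" and v: "v = stretched_exp r" by auto
  have "stretched_exp (b powr (- 1 / \<beta>)) \<le> stretched_exp r"
    using r stretched_exp_less[of "b powr (- 1 / \<beta>)" r] by (cases "b powr (- 1 / \<beta>) = r") auto
  then show "v \<in> {exp 1..}"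
    unfolding v stretched_exp_at_junction(1) by simp
next
  fix v :: real assume v: "v \<in> {exp 1..}"
  then have "v > 0" by (auto intro: less_le_trans[OF exp_gt_zero])
  with v have ln: "ln v \<ge> 1" by (simp add: ln_ge_iff)
  \<comment> \<open>The solution of b r^\<beta> = ln v. It lies at or beyond the junction because ln
    v \<ge> 1 and the junction radius is (1/b)^(1/\<beta>).\<close>
  define r where "r = (ln v / b) powr (1 / \<beta>)"
  have "b * r powr \<beta> = ln v"
    using b \<beta> ln by (simp add: r_def powr_powr)
  then have "stretched_exp r = v"
    using \<open>v > 0\<close> by (simp add: stretched_exp_def)
  moreover have "(1 / b) powr (1 / \<beta>) \<le> r"
    unfolding r_def using b \<beta> ln by (intro powr_mono2) (auto simp: divide_right_mono)
  then have "b powr (- 1 / \<beta>) \<le> r"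
    using b by (simp add: powr_minus_divide powr_divide)
  ultimately show "v \<in> stretched_exp ` {b powr (- 1 / \<beta>)..}"
    by force
qed

end

section \<open>Smoothness, range and monotonicity of the glued profile\<close>

theorem lemma1:
  fixes b \<beta> :: real and f gin :: "real \<Rightarrow> real"
  assumes "b > 0" and "\<beta> \<in> {1<..2}"
    and "C_k_on 2 UNIV f"
    and "G1 b \<beta> f gin"
  defines "g \<equiv> glue b \<beta> gin"
  shows "C_k_on 3 {0<..} g \<and>
    g ` {0..} = {0..} \<and> strict_mono_on {0..} g \<and> bij_betw g {0..} {0..}"
proof -
  define R where "R = b powr (- 1 / \<beta>)"
  have \<beta>: "\<beta> > 1" and R: "R > 0"
    using assms(1,2) by (auto simp: R_def)
  let ?q = "stretched_exp b \<beta>"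
  note at_R = stretched_exp_at_junction[OF assms(1) \<beta>, folded R_def]
  have g: "g = (\<lambda>r. if r < R then gin r else ?q r)"
    using assms(1) \<beta> by (auto simp: g_def glue_def R_def stretched_exp_def)
  from assms(4) have img: "gin ` {0..<R} = {0..<exp 1}"
      and mono: "strict_mono_on {0..<R} gin"
      and C: "C_k_on 3 {0<..<R} gin"
      and lim: "(gin \<longlongrightarrow> exp 1) (at_left R)"
        "(deriv gin \<longlongrightarrow> \<beta> * b powr (1 / \<beta>) * exp 1) (at_left R)"
        "((deriv ^^ 2) gin \<longlongrightarrow> (2 * \<beta>^2 - \<beta>) * b powr (2 / \<beta>) * exp 1) (at_left R)"
        "((deriv ^^ 3) gin \<longlongrightarrow>
          (5 * \<beta>^3 - 6 * \<beta>^2 + 2 * \<beta>) * b powr (3 / \<beta>) * exp 1) (at_left R)"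
    unfolding G1_def Let_def R_def by blast+
  have "((deriv ^^ j) gin \<longlongrightarrow> (deriv ^^ j) ?q R) (at_left R)" if j: "j \<le> 3" for j
  proof -
    \<comment> \<open>Each order pairs one prescribed limit from \<open>G1\<close> with the matching
      derivative of the outer function at \<open>R\<close>.\<close>
    consider "j = 0" | "j = 1" | "j = 2" | "j = 3" using j by linarith
    then show ?thesis
      using lim at_R higher_deriv_stretched_exp[OF assms(1) \<beta> R] by cases simp_all
  qed
  then have C3: "C_k_on 3 {0<..} g"
    unfolding g by (intro C_k_on_if_less[OF R C C_3_on_stretched_exp[OF assms(1) \<beta>]])
  have "g ` {0..} = g ` {0..<R} \<union> g ` {R..}"
    using R by (simp add: image_Un[symmetric] ivl_disj_un)
  also have "g ` {0..<R} = gin ` {0..<R}"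
    by (auto simp: g intro!: image_cong)
  also have "g ` {R..} = ?q ` {R..}"
    by (auto simp: g intro!: image_cong)
  also have "gin ` {0..<R} \<union> ?q ` {R..} = {0..}"
    unfolding img image_stretched_exp[OF assms(1) \<beta>, folded R_def] by (auto intro: order_trans[OF exp_ge_zero])
  finally have onto: "g ` {0..} = {0..}" .
  have "g r < g s" if "0 \<le> r" "r < s" for r s
  proof -
    \<comment> \<open>For r < R \<le> s the value e separates \<open>g r\<close> from
      \<open>g s\<close>; otherwise both points lie in the same piece, which is strictly
      increasing.\<close>
    have inner: "gin r < exp 1" if "r < R"
      using img \<open>0 \<le> r\<close> that by (auto dest: equalityD1)
    have outer: "exp 1 \<le> ?q s" if "R \<le> s"
      using image_stretched_exp[OF assms(1) \<beta>] that unfolding R_def by auto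
    show ?thesis
      using that inner outer strict_mono_onD[OF mono, of r s]
        stretched_exp_less[OF assms(1) \<beta>, of r s] by (auto simp: g)
  qed
  then have strict: "strict_mono_on {0..} g"
    by (auto intro: strict_mono_onI)
  with C3 onto show ?thesis
    by (auto simp: bij_betw_def strict_mono_on_imp_inj_on)
qed

end
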